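(* Let a group $\mathcal{G}$ act on a space $\mathcal{X}$ from the left, and let $\mathcal{H}$ be a subgroup of $\mathcal{G}$. Suppose that there exists a global cross section $\mathcal{Z}$ for the action of $\mathcal{G}$ on $\mathcal{X}$, with the common isotropy subgroup $\mathcal{G}_0$ (that is, $\mathcal{G}_z=\mathcal{G}_0$ for all $z\in\mathcal{Z}$). Suppose moreover that there exists a complete set $\mathcal{G}'=\{g_i: i\in I\}\subset\mathcal{G}$ of representatives of the double cosets $\mathcal{H}g\mathcal{G}_0$, $g\in\mathcal{G}$, in $\mathcal{G}$ such that the isotropy subgroup $\mathcal{H}_{g_i\mathcal{G}_0}=\{h\in\mathcal{H}: hg_i\mathcal{G}_0=g_i\mathcal{G}_0\}$ does not depend on $i\in I$, and let $\mathcal{V}=\{g_i\mathcal{G}_0: i\in I\}\subset\mathcal{G}/\mathcal{G}_0$. Then $\mathcal{V}\times\mathcal{Z}$ is in one-to-one correspondence with $$\tilde{\mathcal{Z}}:=\mathcal{G}'\mathcal{Z}=\{g_iz: i\in I,\ z\in\mathcal{Z}\},$$ and $\tilde{\mathcal{Z}}$ is a global cross section for the action of $\mathcal{H}$ on $\mathcal{X}$.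
   Context: For a group $G$ acting from the left on a set $X$: the isotropy subgroup at $x$ is $G_x=\{g\in G: gx=x\}$; a cross section is a subset of $X$ that intersects each orbit $Gx$, $x\in X$, exactly once; a global cross section is a cross section all of whose points have the same isotropy subgroup. $\mathcal{G}/\mathcal{G}_0=\{g\mathcal{G}_0: g\in\mathcal{G}\}$ is the left coset space, and $\mathcal{H}$ acts on it by $(h,g\mathcal{G}_0)\mapsto (hg)\mathcal{G}_0$. $\mathcal{H}$ acts on $\mathcal{X}$ by restriction of the action of $\mathcal{G}$. The double cosets are $\mathcal{H}g\mathcal{G}_0=\{hgg_0: h\in\mathcal{H},\ g_0\in\mathcal{G}_0\}$; $\{g_i: i\in I\}$ is a complete set of representatives if $\mathcal{G}=\bigsqcup_{i\in I}\mathcal{H}g_i\mathcal{G}_0$ (disjoint union). *)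

theory Defs
  imports "HOL-Library.Disjoint_Sets" "HOL-Algebra.Group_Action" "HOL-Algebra.Left_Coset"
begin

definition cross_section :: "('g, 'm) monoid_scheme \<Rightarrow> 'x set \<Rightarrow> ('g \<Rightarrow> 'x \<Rightarrow> 'x) \<Rightarrow> 'x set \<Rightarrow> bool"
  where "cross_section G X \<phi> Z \<longleftrightarrow> Z \<subseteq> X \<and> (\<forall>orb \<in> orbits G X \<phi>. \<exists>!z. z \<in> Z \<inter> orb)"

definition global_cross_section :: "('g, 'm) monoid_scheme \<Rightarrow> 'x set \<Rightarrow> ('g \<Rightarrow> 'x \<Rightarrow> 'x) \<Rightarrow> 'x set \<Rightarrow> bool"
  where "global_cross_section G X \<phi> Z \<longleftrightarrow>
    cross_section G X \<phi> Z \<and> (\<forall>y \<in> Z. \<forall>z \<in> Z. stabilizer G \<phi> y = stabilizer G \<phi> z)"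

definition double_coset :: "('g, 'm) monoid_scheme \<Rightarrow> 'g set \<Rightarrow> 'g \<Rightarrow> 'g set \<Rightarrow> 'g set"
  where "double_coset G H g K = {h \<otimes>\<^bsub>G\<^esub> g \<otimes>\<^bsub>G\<^esub> k | h k. h \<in> H \<and> k \<in> K}"

text \<open>Disjointness is that of the indexed family; as double cosets are nonempty, distinct indices
  then give distinct representatives of distinct double cosets.\<close>

definition double_coset_representatives ::
    "('g, 'm) monoid_scheme \<Rightarrow> 'g set \<Rightarrow> 'g set \<Rightarrow> 'i set \<Rightarrow> ('i \<Rightarrow> 'g) \<Rightarrow> bool"
  where "double_coset_representatives G H K I g \<longleftrightarrow>
    g ` I \<subseteq> carrier G \<and>
    disjoint_family_on (\<lambda>i. double_coset G H (g i) K) I \<and>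
    (\<Union>i\<in>I. double_coset G H (g i) K) = carrier G"

text \<open>The action of \<open>G\<close> on \<open>G/K\<close> by left translation; an action by a subgroup \<open>H\<close> is
  obtained, here as elsewhere, by replacing \<open>G\<close> with \<open>G\<lparr>carrier := H\<rparr>\<close> as the acting group. The
  restriction to \<open>lcosets\<^bsub>G\<^esub> K\<close> is needed because \<open>group_action\<close> takes extensional functions.\<close>

definition coset_action :: "('g, 'm) monoid_scheme \<Rightarrow> 'g set \<Rightarrow> 'g \<Rightarrow> 'g set \<Rightarrow> 'g set"
  where "coset_action G K g = (\<lambda>C \<in> lcosets\<^bsub>G\<^esub> K. g <#\<^bsub>G\<^esub> C)"

lemma group_action_restrict:
  assumes "group_action G X \<phi>" "subgroup H G"
  shows "group_action (G\<lparr>carrier := H\<rparr>) X \<phi>"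
proof -
  interpret group_action G X \<phi> by fact
  interpret gh: group_hom G "BijGroup X" \<phi> by (rule group_hom)
  have "group (G\<lparr>carrier := H\<rparr>)"
    using assms(2) gh.G.is_group by (rule subgroup.subgroup_is_group)
  moreover have "\<phi> \<in> hom (G\<lparr>carrier := H\<rparr>) (BijGroup X)"
    using gh.homh subgroup.subset[OF assms(2)] by (auto simp: hom_def Pi_def subset_iff)
  ultimately show ?thesis
    by (simp add: group_action_def group_hom_def group_hom_axioms_def gh.H.is_group)
qed

lemma group_action_coset_action:
  assumes "group G" "subgroup K G"
  shows "group_action G (lcosets\<^bsub>G\<^esub> K) (coset_action G K)"
proof -
  interpret group G by fact
  let ?E = "lcosets\<^bsub>G\<^esub> K"
  have K: "K \<subseteq> carrier G" using assms(2) by (rule subgroup.subset)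
  have sub: "C \<subseteq> carrier G" if "C \<in> ?E" for C
    using subgroup.lcosets_carrier[OF assms(2) assms(1) that] .
  have cl: "g <#\<^bsub>G\<^esub> C \<in> ?E" if "g \<in> carrier G" "C \<in> ?E" for g C
    using that K by (auto simp: LCOSETS_def lcos_m_assoc)
  have comp: "g <#\<^bsub>G\<^esub> (h <#\<^bsub>G\<^esub> C) = (g \<otimes>\<^bsub>G\<^esub> h) <#\<^bsub>G\<^esub> C"
    if "g \<in> carrier G" "h \<in> carrier G" "C \<in> ?E" for g h C
    using that sub by (simp add: lcos_m_assoc)
  have one: "\<one>\<^bsub>G\<^esub> <#\<^bsub>G\<^esub> C = C" if "C \<in> ?E" for C
    using sub[OF that] by (rule lcos_mult_one)
  have bij: "coset_action G K g \<in> Bij ?E" if g: "g \<in> carrier G" for g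
  proof -
    have "bij_betw (\<lambda>C. g <#\<^bsub>G\<^esub> C) ?E ?E"
      by (rule bij_betw_byWitness[where f' = "\<lambda>C. inv\<^bsub>G\<^esub> g <#\<^bsub>G\<^esub> C"])
         (use g in \<open>auto simp: cl comp one\<close>)
    then show ?thesis
      by (simp add: Bij_def coset_action_def)
  qed
  have "coset_action G K \<in> hom G (BijGroup ?E)"
  proof (rule homI)
    fix g h assume "g \<in> carrier G" "h \<in> carrier G"
    then show "coset_action G K (g \<otimes>\<^bsub>G\<^esub> h)
        = coset_action G K g \<otimes>\<^bsub>BijGroup ?E\<^esub> coset_action G K h"
      using bij by (auto simp: BijGroup_def coset_action_def compose_def fun_eq_iff cl comp)
  qed (use bij in \<open>simp add: BijGroup_def\<close>)
  then show ?thesis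
    by (simp add: group_action_def group_hom_def group_hom_axioms_def group_BijGroup is_group)
qed

end

theory Submission
  imports Defs
begin

text \<open>
  Two points \<open>a y\<close> and \<open>b z\<close> with \<open>y, z \<in> Z\<close> agree iff \<open>y = z\<close> and
  \<open>a G0 = b G0\<close>. So the \<open>H\<close>-action on the points \<open>g\<^sub>i z\<close> is
  governed by the \<open>H\<close>-action on the cosets \<open>g\<^sub>i G0\<close>, and two such cosets lie in
  one \<open>H\<close>-orbit exactly when their double cosets coincide.
\<close>

lemma (in group) lcos_eq_iff:
  assumes "subgroup K G" "a \<in> carrier G" "b \<in> carrier G"
  shows "a <# K = b <# K \<longleftrightarrow> a \<in> b <# K"
  using assms l_repr_independence lcos_self by metis

text \<open>Orbit-stabilizer argument: \<open>a\<close> and \<open>b\<close> send \<open>x\<close>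
  to the same point exactly when \<open>inv b \<otimes> a\<close> fixes \<open>x\<close>.\<close>

lemma (in group_action) image_eq_iff_lcos_stabilizer:
  assumes x: "x \<in> E" and a: "a \<in> carrier G" and b: "b \<in> carrier G"
  shows "\<phi> a x = \<phi> b x \<longleftrightarrow> a <# stabilizer G \<phi> x = b <# stabilizer G \<phi> x"
proof -
  interpret group G
    using group_hom group_hom.axioms(1) by auto
  have sub: "subgroup (stabilizer G \<phi> x) G"
    using x by (rule stabilizer_subgroup)
  have "\<phi> a x = \<phi> b x \<longleftrightarrow> a \<in> b <# stabilizer G \<phi> x"
  proof
    assume eq: "\<phi> a x = \<phi> b x"
    have "\<phi> (inv b \<otimes> a) x = x"
      using x a b by (metis eq composition_rule inv_closed orbit_sym_aux)
    then have "inv b \<otimes> a \<in> stabilizer G \<phi> x"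
      using a b by (simp add: stabilizer_def)
    moreover have "a = b \<otimes> (inv b \<otimes> a)"
      using a b by (simp add: m_assoc[symmetric])
    ultimately show "a \<in> b <# stabilizer G \<phi> x"
      unfolding l_coset_def by blast
  next
    assume "a \<in> b <# stabilizer G \<phi> x"
    then show "\<phi> a x = \<phi> b x"
      using x b by (auto simp: l_coset_def stabilizer_def composition_rule)
  qed
  then show ?thesis
    using lcos_eq_iff[OF sub a b] by simp
qed

text \<open>The common image lies in the orbits of both \<open>y\<close> and \<open>z\<close>, so
  these orbits coincide, and \<open>Z\<close> meets an orbit only once.\<close>

lemma (in group_action) cross_section_point_unique:
  assumes Z: "cross_section G E \<phi> Z" and yz: "y \<in> Z" "z \<in> Z"
    and ab: "a \<in> carrier G" "b \<in> carrier G" and eq: "\<phi> a y = \<phi> b z"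
  shows "y = z"
proof -
  have E: "y \<in> E" "z \<in> E"
    using Z yz by (auto simp: cross_section_def)
  have "\<phi> a y \<in> orbit G \<phi> y" "\<phi> a y \<in> orbit G \<phi> z"
    using ab eq unfolding orbit_def by blast+
  moreover have "\<phi> a y \<in> E"
    using ab E element_image by blast
  ultimately have "z \<in> orbit G \<phi> y"
    using E orbit_sym orbit_trans by metis
  moreover have "y \<in> orbit G \<phi> y"
    using E orbit_refl by blast
  moreover have "orbit G \<phi> y \<in> orbits G E \<phi>"
    using E by (auto simp: orbits_def)
  ultimately show ?thesis
    using Z yz unfolding cross_section_def by blast
qed

lemma (in group_action) cross_section_cover:
  assumes Z: "cross_section G E \<phi> Z" and x: "x \<in> E"
  obtains a z where "a \<in> carrier G" "z \<in> Z" "x = \<phi> a z"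
proof -
  obtain z where z: "z \<in> Z" "z \<in> orbit G \<phi> x"
    using Z x unfolding cross_section_def orbits_def by blast
  then have "x \<in> orbit G \<phi> z"
    using Z x orbit_sym by (auto simp: cross_section_def)
  with z that show thesis
    by (auto simp: orbit_def)
qed

text \<open>The hypothesis puts \<open>h \<otimes> g i\<close> into the double cosets of both
  \<open>g i\<close> and \<open>g j\<close>, which are disjoint for distinct indices. The case of
  trivial \<open>h\<close> separates the cosets in \<open>V\<close>; general \<open>h\<close>
  separates their \<open>H\<close>-orbits.\<close>

lemma (in group) double_coset_representatives_inj:
  assumes reps: "double_coset_representatives G H K I g"
    and H: "subgroup H G" and K: "subgroup K G"
    and ij: "i \<in> I" "j \<in> I" and h: "h \<in> H" and eq: "(h \<otimes> g i) <# K = g j <# K"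
  shows "i = j"
proof (rule ccontr)
  assume "i \<noteq> j"
  have carr: "g i \<in> carrier G" "g j \<in> carrier G" "h \<in> carrier G"
    using reps ij h subgroup.subset[OF H] by (auto simp: double_coset_representatives_def)
  have "h \<otimes> g i \<in> g j <# K"
    using lcos_self[OF _ K, of "h \<otimes> g i"] carr eq by simp
  then obtain k where k: "k \<in> K" "h \<otimes> g i = g j \<otimes> k"
    by (auto simp: l_coset_def)
  \<comment> \<open>Units are inserted to reach the three-factor form that
    \<open>double_coset\<close> asks for.\<close>
  have "h \<otimes> g i = h \<otimes> g i \<otimes> \<one>" "h \<otimes> g i = \<one> \<otimes> g j \<otimes> k"
    using carr k(2) subgroup.mem_carrier[OF K k(1)] by simp_all
  then have "h \<otimes> g i \<in> double_coset G H (g i) K" "h \<otimes> g i \<in> double_coset G H (g j) K"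
    using h k(1) subgroup.one_closed[OF H] subgroup.one_closed[OF K]
    unfolding double_coset_def by blast+
  moreover have "double_coset G H (g i) K \<inter> double_coset G H (g j) K = {}"
    using reps ij \<open>i \<noteq> j\<close>
    by (auto simp: double_coset_representatives_def disjoint_family_on_def)
  ultimately show False
    by blast
qed

lemma (in group) stabilizer_coset_action:
  assumes H: "subgroup H G" and K: "subgroup K G" and a: "a \<in> carrier G"
  shows "stabilizer (G\<lparr>carrier := H\<rparr>) (coset_action G K) (a <# K)
    = {h \<in> H. (h \<otimes> a) <# K = a <# K}"
proof -
  \<comment> \<open>\<open>coset_action\<close> is \<open>undefined\<close> off the left cosets, so
    membership must be known before it can be evaluated.\<close>
  have "a <# K \<in> lcosets K"
    using a by (auto simp: LCOSETS_def)
  then have "coset_action G K h (a <# K) = (h \<otimes> a) <# K" if "h \<in> H" for h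
    using that a subgroup.subset[OF H] subgroup.subset[OF K]
    by (auto simp: coset_action_def lcos_m_assoc)
  then show ?thesis
    by (auto simp: stabilizer_def)
qed

theorem theorem3p3:
  fixes G :: "('g, 'm) monoid_scheme"
    and X :: "'x set" and \<phi> :: "'g \<Rightarrow> 'x \<Rightarrow> 'x"
    and H G0 :: "'g set" and Z :: "'x set"
    and I :: "'i set" and g :: "'i \<Rightarrow> 'g"
    and V :: "'g set set" and Zt :: "'x set"
  assumes action: "group_action G X \<phi>"
    and H: "subgroup H G"
    and Z: "global_cross_section G X \<phi> Z"
    and G0: "subgroup G0 G" "\<And>z. z \<in> Z \<Longrightarrow> stabilizer G \<phi> z = G0"
    and reps: "double_coset_representatives G H G0 I g"
    and isotropy: "\<And>i j. i \<in> I \<Longrightarrow> j \<in> I \<Longrightarrow>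
          stabilizer (G\<lparr>carrier := H\<rparr>) (coset_action G G0) (g i <#\<^bsub>G\<^esub> G0)
        = stabilizer (G\<lparr>carrier := H\<rparr>) (coset_action G G0) (g j <#\<^bsub>G\<^esub> G0)"
  defines "V \<equiv> {g i <#\<^bsub>G\<^esub> G0 | i. i \<in> I}"
    and "Zt \<equiv> {\<phi> (g i) z | i z. i \<in> I \<and> z \<in> Z}"
  shows "(\<exists>f. bij_betw f (V \<times> Z) Zt \<and>
              (\<forall>i \<in> I. \<forall>z \<in> Z. f (g i <#\<^bsub>G\<^esub> G0, z) = \<phi> (g i) z)) \<and>
         global_cross_section (G\<lparr>carrier := H\<rparr>) X \<phi> Zt"
proof -
  interpret group_action G X \<phi> by (rule action)
  interpret grp: group G
    using group_hom group_hom.axioms(1) by auto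
  interpret act_H: group_action "G\<lparr>carrier := H\<rparr>" X \<phi>
    using action H by (rule group_action_restrict)
  have cs: "cross_section G X \<phi> Z"
    using Z by (simp add: global_cross_section_def)
  have ZX: "z \<in> X" if "z \<in> Z" for z
    using cs that by (auto simp: cross_section_def)
  have gc: "g i \<in> carrier G" if "i \<in> I" for i
    using reps that by (auto simp: double_coset_representatives_def)
  have Hc: "h \<in> carrier G" if "h \<in> H" for h
    using subgroup.subset[OF H] that by blast
  \<comment> \<open>All points of \<open>Z\<close> share the stabilizer \<open>G0\<close>, so the
    coset condition does not depend on the point. Every later comparison of points goes through this
    equivalence.\<close>
  have \<phi>_eq_iff: "\<phi> a y = \<phi> b z \<longleftrightarrow> y = z \<and> a <#\<^bsub>G\<^esub> G0 = b <#\<^bsub>G\<^esub> G0"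
    if "y \<in> Z" "z \<in> Z" "a \<in> carrier G" "b \<in> carrier G" for a b y z
    using that cross_section_point_unique[OF cs] image_eq_iff_lcos_stabilizer G0(2) ZX by metis
  have index_eq: "i = j"
    if "i \<in> I" "j \<in> I" "h \<in> H" "(h \<otimes>\<^bsub>G\<^esub> g i) <#\<^bsub>G\<^esub> G0 = g j <#\<^bsub>G\<^esub> G0" for i j h
    using grp.double_coset_representatives_inj[OF reps H G0(1)] that by blast
  have inj: "inj_on (\<lambda>i. g i <#\<^bsub>G\<^esub> G0) I"
    using index_eq[OF _ _ subgroup.one_closed[OF H]] gc by (auto intro!: inj_onI)

  \<comment> \<open>The map receives a coset, not an index. \<open>inv_into\<close> recovers the
    index, and \<open>inj\<close> makes it the intended one.\<close>
  define f where "f = (\<lambda>(C, z). \<phi> (g (inv_into I (\<lambda>i. g i <#\<^bsub>G\<^esub> G0) C)) z)"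
  have f: "f (g i <#\<^bsub>G\<^esub> G0, z) = \<phi> (g i) z" if "i \<in> I" for i z
    using inv_into_f_f[OF inj that] by (simp add: f_def)
  have "bij_betw f (V \<times> Z) Zt"
  proof (rule bij_betw_imageI)
    show "inj_on f (V \<times> Z)"
      by (rule inj_onI) (auto simp: V_def f \<phi>_eq_iff gc)
    show "f ` (V \<times> Z) = Zt"
    proof
      show "f ` (V \<times> Z) \<subseteq> Zt"
        by (auto simp: V_def Zt_def f) blast
      show "Zt \<subseteq> f ` (V \<times> Z)"
      proof
        fix x assume "x \<in> Zt"
        then obtain i z where "i \<in> I" "z \<in> Z" "x = f (g i <#\<^bsub>G\<^esub> G0, z)"
          by (auto simp: Zt_def f)
        then show "x \<in> f ` (V \<times> Z)"
          by (auto simp: V_def)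
      qed
    qed
  qed
  moreover have "cross_section (G\<lparr>carrier := H\<rparr>) X \<phi> Zt"
    unfolding cross_section_def
  proof (intro conjI ballI)
    show "Zt \<subseteq> X"
      using gc ZX element_image unfolding Zt_def by blast
    fix orb assume "orb \<in> orbits (G\<lparr>carrier := H\<rparr>) X \<phi>"
    then obtain x where x: "x \<in> X" and orb: "orb = orbit (G\<lparr>carrier := H\<rparr>) \<phi> x"
      by (auto simp: orbits_def)
    obtain a z where a: "a \<in> carrier G" and z: "z \<in> Z" and xa: "x = \<phi> a z"
      using cross_section_cover[OF cs x] .
    \<comment> \<open>Existence: factor \<open>a\<close> through its double coset. The last factor
      \<open>k\<close> fixes \<open>z\<close>, so \<open>x\<close> is an \<open>H\<close>-translate
      of \<open>\<phi> (g i) z\<close>, the candidate point of \<open>Zt\<close> in the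
      orbit.\<close>
    obtain i h k where i: "i \<in> I" and h: "h \<in> H" and k: "k \<in> G0"
      and a_eq: "a = h \<otimes>\<^bsub>G\<^esub> g i \<otimes>\<^bsub>G\<^esub> k"
      using reps a unfolding double_coset_representatives_def double_coset_def by blast
    have hg: "h \<otimes>\<^bsub>G\<^esub> g i \<in> carrier G"
      using Hc[OF h] gc[OF i] by simp
    have "a \<in> (h \<otimes>\<^bsub>G\<^esub> g i) <#\<^bsub>G\<^esub> G0"
      using k a_eq by (auto simp: l_coset_def)
    then have x_eq: "x = \<phi> h (\<phi> (g i) z)"
      using grp.lcos_eq_iff[OF G0(1) a hg] \<phi>_eq_iff[OF z z a hg] xa
        composition_rule[OF ZX[OF z] Hc[OF h] gc[OF i]] by simp
    have giX: "\<phi> (g i) z \<in> X"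
      using gc[OF i] ZX[OF z] element_image by blast
    have x_orb: "x \<in> orbit (G\<lparr>carrier := H\<rparr>) \<phi> (\<phi> (g i) z)"
      using h x_eq by (auto simp: orbit_def)
    show "\<exists>!z. z \<in> Zt \<inter> orb"
    proof (rule ex1I)
      show "\<phi> (g i) z \<in> Zt \<inter> orb"
        using i z act_H.orbit_sym[OF giX x x_orb] by (auto simp: Zt_def orb)
      fix w assume w: "w \<in> Zt \<inter> orb"
      then obtain j y where j: "j \<in> I" and y: "y \<in> Z" and w_eq: "w = \<phi> (g j) y"
        by (auto simp: Zt_def)
      have "w \<in> X"
        using gc[OF j] ZX[OF y] w_eq element_image by blast
      then have "w \<in> orbit (G\<lparr>carrier := H\<rparr>) \<phi> (\<phi> (g i) z)"
        using act_H.orbit_trans[OF giX x _ x_orb] w orb by blast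
      then obtain h' where h': "h' \<in> H" and "w = \<phi> h' (\<phi> (g i) z)"
        by (auto simp: orbit_def)
      then have eq: "\<phi> (h' \<otimes>\<^bsub>G\<^esub> g i) z = \<phi> (g j) y"
        using composition_rule[OF ZX[OF z] Hc[OF h'] gc[OF i]] w_eq by simp
      \<comment> \<open>Uniqueness: the point of \<open>Z\<close> is determined by the
        \<open>G\<close>-orbit, and the index by the \<open>H\<close>-orbit of the coset.\<close>
      have "z = y \<and> (h' \<otimes>\<^bsub>G\<^esub> g i) <#\<^bsub>G\<^esub> G0 = g j <#\<^bsub>G\<^esub> G0"
        using eq \<phi>_eq_iff z y Hc[OF h'] gc[OF i] gc[OF j] by blast
      then show "w = \<phi> (g i) z"
        using index_eq[OF i j h'] w_eq by simp
    qed
  qed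
  \<comment> \<open>This turns the isotropy hypothesis on cosets into one on points: with the same
    \<open>z\<close> on both sides, \<open>\<phi>_eq_iff\<close> says that \<open>h\<close> fixes
    \<open>\<phi> (g i) z\<close> iff it fixes the coset of \<open>g i\<close>.\<close>
  moreover have "stabilizer (G\<lparr>carrier := H\<rparr>) \<phi> (\<phi> (g i) z)
      = stabilizer (G\<lparr>carrier := H\<rparr>) (coset_action G G0) (g i <#\<^bsub>G\<^esub> G0)"
    if i: "i \<in> I" and z: "z \<in> Z" for i z
  proof -
    have "\<phi> h (\<phi> (g i) z) = \<phi> (g i) z \<longleftrightarrow> (h \<otimes>\<^bsub>G\<^esub> g i) <#\<^bsub>G\<^esub> G0 = g i <#\<^bsub>G\<^esub> G0"
      if "h \<in> H" for h
      using \<phi>_eq_iff[OF z z _ gc[OF i], of "h \<otimes>\<^bsub>G\<^esub> g i"]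
        composition_rule[OF ZX[OF z] Hc[OF that] gc[OF i]] Hc[OF that] gc[OF i] by simp
    then show ?thesis
      by (auto simp: grp.stabilizer_coset_action[OF H G0(1) gc[OF i]]) (auto simp: stabilizer_def)
  qed
  then have "\<forall>y \<in> Zt. \<forall>z \<in> Zt.
      stabilizer (G\<lparr>carrier := H\<rparr>) \<phi> y = stabilizer (G\<lparr>carrier := H\<rparr>) \<phi> z"
    unfolding Zt_def using isotropy by blast
  ultimately show ?thesis
    using f unfolding global_cross_section_def by blast
qed

end
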